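(* Let $I_\cap$ be a measure of shared information that satisfies the Williams–Beer axioms and has the pairwise secret sharing property. Then $I_\partial$ is not nonnegative; that is, there exist $n\ge 1$, random variables $S,X_1,\dots,X_n$ and an antichain $(A_1,\dots,A_k)$ of subsets of $\{1,\dots,n\}$ such that $I_\partial(S;A_1,\dots,A_k)<0$.
   Context: All random variables take finitely many values; $H$ is Shannon entropy, $I$ is mutual information. For $A\subseteq\{1,\dots,n\}$ write $X_A=(X_i)_{i\in A}$ ($X_\emptyset$ is constant). **Measure of shared information.** A function $I_\cap$ assigning to jointly distributed random variables $S$ (the target) and $Y_1,\dots,Y_k$ ($k\ge1$) a real number $I_\cap(S;Y_1,\dots,Y_k)$ that depends only on the joint distribution and does not change if the values of the variables (in particular of the target) are relabelled bijectively. Given $X_1,\dots,X_n$ and $A_1,\dots,A_k\subseteq\{1,\dots,n\}$, write $I_\cap(S;A_1,\dots,A_k):=I_\cap(S;X_{A_1},\dots,X_{A_k})$. **Williams–Beer axioms.** (Symmetry) $I_\cap(S;Y_1,\dots,Y_k)$ is symmetric under permutations of $Y_1,\dots,Y_k$. (Self-redundancy) $I_\cap(S;Y_1)=I(S;Y_1)$. (Monotonicity) $I_\cap(S;Y_1,\dots,Y_k,Y_{k+1})\le I_\cap(S;Y_1,\dots,Y_k)$, with equality if $Y_i$ is a function of $Y_{k+1}$ for some $i\in\{1,\dots,k\}$. **Access structures and secret sharing.** An access structure $\mathcal A$ on $\{1,\dots,n\}$ is a family of subsets of $\{1,\dots,n\}$ closed under taking supersets; its elements are called authorized. A perfect secret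 sharing scheme with access structure $\mathcal A$ is a family of random variables $S,X_1,\dots,X_n$ with $H(X_A,S)=H(X_A)$ whenever $A\in\mathcal A$ and $H(X_A,S)=H(X_A)+H(S)$ whenever $A\notin\mathcal A$. A combination of perfect secret sharing schemes with access structures $\mathcal A_1,\dots,\mathcal A_l$ on $\{1,\dots,n\}$ consists of random variables $S_1,\dots,S_l,X_1,\dots,X_n$ such that for each $i$, $(S_i,X_1,\dots,X_n)$ is a perfect secret sharing scheme with access structure $\mathcal A_i$, and $H(S_i\mid S_1,\dots,S_{i-1},S_{i+1},\dots,S_l,X_A)=H(S_i)$ whenever $A\notin\mathcal A_i$. **Pairwise secret sharing property.** For every combination of $l=2$ perfect secret sharing schemes with access structures $\mathcal A_1,\mathcal A_2$ on $\{1,\dots,n\}$ (any $n$) and all $A_1,\dots,A_k\subseteq\{1,\dots,n\}$, $$I_\cap\big((S_1,S_2);A_1,\dots,A_k\big)=H\big(\{S_i: A_1,\dots,A_k\in\mathcal A_i\}\big),$$ the joint entropy of those secrets for which all of $A_1,\dots,A_k$ are authorized (zero if there is none). **Partial information terms.** An antichain is a nonempty collection $(A_1,\dots,A_k)$ of nonempty subsets of $\{1,\dots,n\}$, none contained in another; the order of the elements is irrelevant. Antichains are ordered by: $(A_1,\dots,A_k)\preceq(B_1,\dots,B_l)$ iff for every $B_i$ there is an $A_j$ with $A_j\subseteq B_i$. For given $S,X_1,\dots,X_n$, the function $I_\partial(S;\cdot)$ on antichains is the unique one (Möbius inversion) with $$I_\cap(S;A_1,\dots,A_k)=\sum_{(B_1,\dots,B_l)\preceq(A_1,\dots,A_k)}I_\partial(S;B_1,\dots,B_l)$$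 for all antichains $(A_1,\dots,A_k)$. *)

theory Defs
  imports "HOL-Probability.Probability"
begin

text \<open>
  A probability space is given by a \<open>pmf\<close> on its sample space.  The constants of
  \<^theory>\<open>HOL-Probability.Information\<close> are used with counting measures on the ranges, as in the
  notation \<open>\<H>(X)\<close>, \<open>\<H>(X | Y)\<close>, \<open>\<I>(X ; Y)\<close> of the locale \<^locale>\<open>information_space\<close>;
  \<open>b > 1\<close> is the base of the logarithm.  They are meaningful for random variables of finite range.
\<close>

definition H :: "real \<Rightarrow> 'w pmf \<Rightarrow> ('w \<Rightarrow> 'a) \<Rightarrow> real" where
  "H b p X = prob_space.entropy (measure_pmf p) b (count_space (range X)) X"

definition cond_H :: "real \<Rightarrow> 'w pmf \<Rightarrow> ('w \<Rightarrow> 'a) \<Rightarrow> ('w \<Rightarrow> 'c) \<Rightarrow> real" where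
  "cond_H b p X Y =
     prob_space.conditional_entropy (measure_pmf p) b (count_space (range X)) (count_space (range Y)) X Y"

definition MI :: "real \<Rightarrow> 'w pmf \<Rightarrow> ('w \<Rightarrow> 'a) \<Rightarrow> ('w \<Rightarrow> 'c) \<Rightarrow> real" where
  "MI b p X Y =
     prob_space.mutual_information (measure_pmf p) b (count_space (range X)) (count_space (range Y)) X Y"

definition finite_valued :: "('w \<Rightarrow> 'a) \<Rightarrow> bool" where
  "finite_valued X \<longleftrightarrow> finite (range X)"

text \<open>
  A measure of shared information takes random variables with arbitrary finite value sets.
  The following type serves as a universe of values.  It is infinite and closed under forming
  tuples, so every finite system of finite-valued random variables, and every variable
  \<open>X_A = (X_i)_{i \<in> A}\<close> built from it, has values in it up to bijective relabelling.
\<close>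

datatype val = Atom nat | Tuple "val list"

text \<open>The entries of \<open>X_A\<close> are listed by increasing index; \<open>X_{}\<close> is constant.\<close>

definition joint :: "(nat \<Rightarrow> 'w \<Rightarrow> val) \<Rightarrow> nat set \<Rightarrow> 'w \<Rightarrow> val" where
  "joint X A = (\<lambda>\<omega>. Tuple (map (\<lambda>i. X i \<omega>) (sorted_list_of_set A)))"

text \<open>
  Sample spaces of random variables that are fed into a measure of shared information are taken
  to be \<open>nat\<close>; every finite joint distribution is realised on it, and by the first clause
  of \<open>shared_information_measure\<close> below only the joint distribution matters.
\<close>

type_synonym rv = "nat \<Rightarrow> val"

type_synonym info_measure = "nat pmf \<Rightarrow> rv \<Rightarrow> rv list \<Rightarrow> real"

definition rv_system :: "rv \<Rightarrow> rv list \<Rightarrow> bool" where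
  "rv_system S Ys \<longleftrightarrow> finite_valued S \<and> Ys \<noteq> [] \<and> (\<forall>Y\<in>set Ys. finite_valued Y)"

definition joint_law :: "nat pmf \<Rightarrow> rv \<Rightarrow> rv list \<Rightarrow> (val \<times> val list) pmf" where
  "joint_law p S Ys = map_pmf (\<lambda>\<omega>. (S \<omega>, map (\<lambda>Y. Y \<omega>) Ys)) p"

definition relabelling :: "('w \<Rightarrow> 'a) \<Rightarrow> ('w \<Rightarrow> 'c) \<Rightarrow> bool" where
  "relabelling X X' \<longleftrightarrow> (\<exists>f. bij_betw f (range X) (range X') \<and> X' = f \<circ> X)"

definition shared_information_measure :: "info_measure \<Rightarrow> bool" where
  "shared_information_measure I \<longleftrightarrow>
     (\<forall>p S Ys p' S' Ys'. rv_system S Ys \<and> rv_system S' Ys' \<and> joint_law p S Ys = joint_law p' S' Ys'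
        \<longrightarrow> I p S Ys = I p' S' Ys') \<and>
     (\<forall>p S Ys S' Ys'. rv_system S Ys \<and> relabelling S S' \<and> list_all2 relabelling Ys Ys'
        \<longrightarrow> I p S Ys = I p S' Ys')"

definition symmetry :: "info_measure \<Rightarrow> bool" where
  "symmetry I \<longleftrightarrow>
     (\<forall>p S Ys Zs. rv_system S Ys \<and> mset Ys = mset Zs \<longrightarrow> I p S Ys = I p S Zs)"

definition self_redundancy :: "real \<Rightarrow> info_measure \<Rightarrow> bool" where
  "self_redundancy b I \<longleftrightarrow>
     (\<forall>p S Y. finite_valued S \<and> finite_valued Y \<longrightarrow> I p S [Y] = MI b p S Y)"

definition function_of :: "nat pmf \<Rightarrow> rv \<Rightarrow> rv \<Rightarrow> bool" where
  "function_of p Y Z \<longleftrightarrow> (\<exists>f. AE \<omega> in measure_pmf p. Y \<omega> = f (Z \<omega>))"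

definition monotonicity :: "info_measure \<Rightarrow> bool" where
  "monotonicity I \<longleftrightarrow>
     (\<forall>p S Ys Z. rv_system S Ys \<and> finite_valued Z \<longrightarrow>
        I p S (Ys @ [Z]) \<le> I p S Ys \<and>
        ((\<exists>Y\<in>set Ys. function_of p Y Z) \<longrightarrow> I p S (Ys @ [Z]) = I p S Ys))"

definition williams_beer :: "real \<Rightarrow> info_measure \<Rightarrow> bool" where
  "williams_beer b I \<longleftrightarrow> symmetry I \<and> self_redundancy b I \<and> monotonicity I"

definition shared_info ::
    "info_measure \<Rightarrow> nat pmf \<Rightarrow> rv \<Rightarrow> (nat \<Rightarrow> rv) \<Rightarrow> nat set list \<Rightarrow> real" where
  "shared_info I p S X As = I p S (map (joint X) As)"

definition access_structure :: "nat \<Rightarrow> nat set set \<Rightarrow> bool" where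
  "access_structure n \<A> \<longleftrightarrow>
     \<A> \<subseteq> Pow {1..n} \<and> (\<forall>A\<in>\<A>. \<forall>B. A \<subseteq> B \<and> B \<subseteq> {1..n} \<longrightarrow> B \<in> \<A>)"

definition perfect_scheme ::
    "real \<Rightarrow> nat \<Rightarrow> nat set set \<Rightarrow> 'w pmf \<Rightarrow> ('w \<Rightarrow> val) \<Rightarrow> (nat \<Rightarrow> 'w \<Rightarrow> val) \<Rightarrow> bool" where
  "perfect_scheme b n \<A> p S X \<longleftrightarrow>
     access_structure n \<A> \<and> finite_valued S \<and> (\<forall>i\<in>{1..n}. finite_valued (X i)) \<and>
     (\<forall>A. A \<subseteq> {1..n} \<longrightarrow>
        (A \<in> \<A> \<longrightarrow> H b p (\<lambda>\<omega>. (joint X A \<omega>, S \<omega>)) = H b p (joint X A)) \<and>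
        (A \<notin> \<A> \<longrightarrow> H b p (\<lambda>\<omega>. (joint X A \<omega>, S \<omega>)) = H b p (joint X A) + H b p S))"

definition scheme_combination ::
    "real \<Rightarrow> nat \<Rightarrow> nat \<Rightarrow> (nat \<Rightarrow> nat set set) \<Rightarrow> 'w pmf \<Rightarrow>
       (nat \<Rightarrow> 'w \<Rightarrow> val) \<Rightarrow> (nat \<Rightarrow> 'w \<Rightarrow> val) \<Rightarrow> bool" where
  "scheme_combination b n l \<A> p S X \<longleftrightarrow>
     (\<forall>i\<in>{1..l}. perfect_scheme b n (\<A> i) p (S i) X \<and>
        (\<forall>A. A \<subseteq> {1..n} \<and> A \<notin> \<A> i \<longrightarrow>
           cond_H b p (S i) (\<lambda>\<omega>. (joint S ({1..l} - {i}) \<omega>, joint X A \<omega>)) = H b p (S i)))"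

text \<open>The entropy of the empty family of secrets is that of a constant, i.e. zero.\<close>

definition pairwise_secret_sharing :: "real \<Rightarrow> info_measure \<Rightarrow> bool" where
  "pairwise_secret_sharing b I \<longleftrightarrow>
     (\<forall>n \<A> p S X As.
        scheme_combination b n 2 \<A> p S X \<and> As \<noteq> [] \<and> set As \<subseteq> Pow {1..n} \<longrightarrow>
        shared_info I p (joint S {1, 2}) X As = H b p (joint S {i \<in> {1, 2}. set As \<subseteq> \<A> i}))"

text \<open>Since the order of the elements of an antichain is irrelevant, antichains are sets.\<close>

definition antichains :: "nat \<Rightarrow> nat set set set" where
  "antichains n =
     {\<AA>. \<AA> \<noteq> {} \<and> \<AA> \<subseteq> Pow {1..n} - {{}} \<and> (\<forall>A\<in>\<AA>. \<forall>B\<in>\<AA>. A \<subseteq> B \<longrightarrow> A = B)}"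

definition antichain_le :: "nat set set \<Rightarrow> nat set set \<Rightarrow> bool" where
  "antichain_le \<AA> \<BB> \<longleftrightarrow> (\<forall>B\<in>\<BB>. \<exists>A\<in>\<AA>. A \<subseteq> B)"

text \<open>
  The partial information term is the unique function on antichains (extended by \<open>undefined\<close>
  elsewhere) that inverts the shared information.  The defining equation is required for every
  enumeration \<open>As\<close> of an antichain; for a symmetric \<open>I\<close> all enumerations agree.
\<close>

definition partial_info ::
    "info_measure \<Rightarrow> nat \<Rightarrow> nat pmf \<Rightarrow> rv \<Rightarrow> (nat \<Rightarrow> rv) \<Rightarrow> nat set set \<Rightarrow> real" where
  "partial_info I n p S X =
     (THE d. d \<in> extensional (antichains n) \<and>
        (\<forall>As. distinct As \<and> set As \<in> antichains n \<longrightarrow>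
           shared_info I p S X As = (\<Sum>\<BB> | \<BB> \<in> antichains n \<and> antichain_le \<BB> (set As). d \<BB>)))"

end

theory Submission
  imports Defs
begin

text \<open>
  The counterexample is the parity distribution: \<open>X\<^sub>1, X\<^sub>2, X\<^sub>3\<close> are pairwise independent
  uniform bits, any two of which determine the third and the target \<open>S\<close>.  For \<open>i \<noteq> j\<close> the
  target is, up to relabelling, the pair \<open>(X\<^sub>i, X\<^sub>j)\<close>, and the two independent variables are
  themselves a combination of two schemes whose secrets are \<open>X\<^sub>i\<close> and \<open>X\<^sub>j\<close>; hence
  \<open>I\<^sub>\<inter>(S; {i}, {j}) = 0\<close>.  With \<open>{j, k}\<close> the complement of \<open>{i}\<close>, the Williams--Beer axioms
  give \<open>I\<^sub>\<inter>(S; {i}, {j, k}) = I(S; X\<^sub>i)\<close>, that is, one bit, and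
  \<open>I\<^sub>\<inter>(S; {1, 2}, {1, 3}, {2, 3}) = H(S)\<close>, that is, two bits.  If all partial terms were
  nonnegative, the three antichains \<open>({i}, {j, k})\<close> would contribute one bit each to the last
  quantity: an antichain below two of them is below some \<open>({i}, {j})\<close> and contributes nothing.
  This would force \<open>3 \<le> 2\<close>.
\<close>

section \<open>Entropy of finite-valued random variables\<close>

lemma information_space_pmf:
  assumes "b > 1"
  shows "information_space (measure_pmf p) b"
  by (intro information_space.intro information_space_axioms.intro measure_pmf.prob_space_axioms assms)

lemma simple_function_pmf:
  "finite_valued X \<Longrightarrow> simple_function (measure_pmf p) X"
  by (simp add: simple_function_def finite_valued_def)

lemma finite_valued_Pair:
  assumes "finite_valued X" "finite_valued Y"
  shows "finite_valued (\<lambda>\<omega>. (X \<omega>, Y \<omega>))"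
  unfolding finite_valued_def
  by (rule finite_subset[where B = "range X \<times> range Y"])
     (use assms in \<open>auto simp: finite_valued_def\<close>)

text \<open>\<open>range X\<close> may contain values of probability zero; the factor zero removes
  their summands.\<close>

lemma H_eq_sum:
  assumes "b > 1" "finite_valued X"
  shows "H b p X = - (\<Sum>x\<in>range X. measure p (X -` {x}) * log b (measure p (X -` {x})))"
proof -
  interpret information_space "measure_pmf p" b
    by (rule information_space_pmf[OF assms(1)])
  have "simple_distributed p X (\<lambda>x. measure p (X -` {x}))"
    by (rule measure_pmf.simple_distributedI[OF simple_function_pmf[OF assms(2)]]) auto
  from entropy_simple_distributed[OF this] show ?thesis
    by (simp add: H_def)
qed

text \<open>Entropy depends only on the partition of the sample space into fibres. Comparing
  entropies of tuples thus reduces to comparing when their values agree.\<close>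

lemma H_cong:
  assumes "b > 1" "finite_valued X" and eq: "\<And>\<omega> \<omega>'. X \<omega> = X \<omega>' \<longleftrightarrow> Y \<omega> = Y \<omega>'"
  shows "H b p X = H b p Y"
proof -
  define f where "f x = Y (inv X x)" for x
  have f: "f (X \<omega>) = Y \<omega>" for \<omega>
    unfolding f_def using eq by (metis f_inv_into_f rangeI)
  have range: "range Y = f ` range X"
    using f by (auto simp: image_iff)
  then have finY: "finite_valued Y"
    using assms(2) by (simp add: finite_valued_def)
  have inj: "inj_on f (range X)"
    using eq f by (auto simp: inj_on_def)
  have vim: "Y -` {f x} = X -` {x}" if "x \<in> range X" for x
    using that eq f by (auto simp: f)
  show ?thesis
    unfolding H_eq_sum[OF assms(1,2)] H_eq_sum[OF assms(1) finY] range
    by (simp add: sum.reindex[OF inj] vim)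
qed

lemma H_uniform:
  fixes p :: "'w pmf"
  assumes "b > 1" "finite_valued X"
    and "\<And>x. x \<in> range X \<Longrightarrow> measure p (X -` {x}) = 1 / real (card (range X))"
  shows "H b p X = log b (real (card (range X)))"
proof -
  have "card (range X) > 0"
    using assms(2) by (simp add: finite_valued_def card_gt_0_iff)
  then show ?thesis
    using assms(1) by (simp add: H_eq_sum[OF assms(1,2)] assms(3) log_divide)
qed

lemma H_const:
  assumes "b > 1"
  shows "H b p (\<lambda>\<omega>. c) = 0"
  using H_uniform[OF assms, of "\<lambda>\<omega>. c" p] by (simp add: finite_valued_def)

lemma cond_H_eq:
  assumes "b > 1" "finite_valued X" "finite_valued Y"
  shows "cond_H b p X Y = H b p (\<lambda>\<omega>. (Y \<omega>, X \<omega>)) - H b p Y"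
proof -
  interpret information_space "measure_pmf p" b
    by (rule information_space_pmf[OF assms(1)])
  show ?thesis
    using entropy_chain_rule[OF simple_function_pmf[OF assms(3)] simple_function_pmf[OF assms(2)]]
    by (simp add: H_def cond_H_def)
qed

lemma MI_eq:
  assumes "b > 1" "finite_valued X" "finite_valued Y"
  shows "MI b p X Y = H b p X + H b p Y - H b p (\<lambda>\<omega>. (X \<omega>, Y \<omega>))"
proof -
  interpret information_space "measure_pmf p" b
    by (rule information_space_pmf[OF assms(1)])
  have "H b p (\<lambda>\<omega>. (Y \<omega>, X \<omega>)) = H b p (\<lambda>\<omega>. (X \<omega>, Y \<omega>))"
    by (rule H_cong[OF assms(1) finite_valued_Pair[OF assms(3,2)]]) auto
  with mutual_information_eq_entropy_conditional_entropy
      [OF simple_function_pmf[OF assms(2)] simple_function_pmf[OF assms(3)]]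
  show ?thesis
    using cond_H_eq[OF assms] by (simp add: H_def MI_def cond_H_def)
qed

text \<open>Since \<open>X\<close> determines \<open>Y\<close>, the pair has the same fibres as
  \<open>X\<close>, and its entropy cancels against that of \<open>X\<close>.\<close>

lemma MI_function:
  assumes "b > 1" "finite_valued X" "\<And>\<omega> \<omega>'. X \<omega> = X \<omega>' \<Longrightarrow> Y \<omega> = Y \<omega>'" "finite_valued Y"
  shows "MI b p X Y = H b p Y"
proof -
  have "H b p (\<lambda>\<omega>. (X \<omega>, Y \<omega>)) = H b p X"
    by (rule H_cong[OF assms(1) finite_valued_Pair[OF assms(2,4)]]) (metis assms(3) prod.inject)
  then show ?thesis
    using MI_eq[OF assms(1,2,4)] by simp
qed

section \<open>Joint variables\<close>

lemma joint_eq_iff: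
  assumes "finite A"
  shows "joint X A \<omega> = joint X A \<omega>' \<longleftrightarrow> (\<forall>i\<in>A. X i \<omega> = X i \<omega>')"
  using assms by (simp add: joint_def)

lemma finite_valued_joint:
  assumes "finite A" "\<And>i. i \<in> A \<Longrightarrow> finite_valued (X i)"
  shows "finite_valued (joint X A)"
proof -
  let ?B = "\<Union>i\<in>A. range (X i)"
  have "range (joint X A) \<subseteq> Tuple ` {xs. set xs \<subseteq> ?B \<and> length xs = card A}"
    using assms(1) by (auto simp: joint_def intro!: imageI; blast)
  moreover have "finite {xs. set xs \<subseteq> ?B \<and> length xs = card A}"
    by (rule finite_lists_length_eq) (use assms in \<open>auto simp: finite_valued_def\<close>)
  ultimately show ?thesis
    unfolding finite_valued_def by (meson finite_imageI finite_subset)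
qed

text \<open>Variables with equal fibres differ by a bijection of their ranges, sending the value on
  a fibre to the other value on it. This criterion spares writing down bijections.\<close>

lemma relabelling_iff:
  "relabelling X Y \<longleftrightarrow> (\<forall>\<omega> \<omega>'. X \<omega> = X \<omega>' \<longleftrightarrow> Y \<omega> = Y \<omega>')"
proof
  assume "relabelling X Y"
  then show "\<forall>\<omega> \<omega>'. X \<omega> = X \<omega>' \<longleftrightarrow> Y \<omega> = Y \<omega>'"
    by (auto simp: relabelling_def bij_betw_def inj_on_def)
next
  assume eq: "\<forall>\<omega> \<omega>'. X \<omega> = X \<omega>' \<longleftrightarrow> Y \<omega> = Y \<omega>'"
  define f where "f x = Y (inv X x)" for x
  have f: "f (X \<omega>) = Y \<omega>" for \<omega>
    unfolding f_def using eq by (metis f_inv_into_f rangeI)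
  then have "bij_betw f (range X) (range Y)"
    using eq by (auto simp: bij_betw_def inj_on_def image_image)
  then show "relabelling X Y"
    unfolding relabelling_def using f by (intro exI[of _ f]) auto
qed

lemma function_ofI:
  assumes "\<And>\<omega> \<omega>'. Z \<omega> = Z \<omega>' \<Longrightarrow> Y \<omega> = Y \<omega>'"
  shows "function_of p Y Z"
proof -
  have "Y \<omega> = (Y \<circ> inv Z) (Z \<omega>)" for \<omega>
    unfolding comp_def by (rule assms) (simp add: f_inv_into_f)
  then show ?thesis
    unfolding function_of_def by (intro exI[of _ "Y \<circ> inv Z"] AE_I2)
qed

section \<open>Independent variables as secret sharing schemes\<close>

text \<open>Each variable is at once a secret and a share, and a set is authorized for secret
  \<open>i\<close> when it contains \<open>i\<close>. An unauthorized set therefore holds at most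
  the other variable, which is independent of the secret.\<close>

lemma independent_pair_scheme_combination:
  fixes p :: "'w pmf" and X :: "nat \<Rightarrow> 'w \<Rightarrow> val"
  assumes b: "b > 1" and fin: "finite_valued (X 1)" "finite_valued (X 2)"
    and indep: "H b p (\<lambda>\<omega>. (X 1 \<omega>, X 2 \<omega>)) = H b p (X 1) + H b p (X 2)"
  shows "scheme_combination b 2 2 (\<lambda>i. {A. A \<subseteq> {1..2} \<and> i \<in> A}) p X X"
proof -
  have fin': "finite_valued (X i)" if "i \<in> {1..2}" for i
  proof -
    have "i = 1 \<or> i = 2" using that by auto
    then show ?thesis using fin by auto
  qed
  have finj: "finite_valued (joint X A)" if "A \<subseteq> {1..2}" for A
    using finite_valued_joint[of A X] fin' that finite_subset[OF that] by blast
  have Ij: "H b p (\<lambda>\<omega>. (joint X A \<omega>, X i \<omega>)) = H b p (joint X A) + H b p (X i)"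
    if A: "A \<subseteq> {1..2}" "i \<in> {1..2}" "i \<notin> A" for A i
  proof (cases "A = {}")
    case True
    have "H b p (\<lambda>\<omega>. (joint X A \<omega>, X i \<omega>)) = H b p (X i)"
      by (rule H_cong[OF b finite_valued_Pair[OF finj fin']]) (use A True in \<open>auto simp: joint_def\<close>)
    moreover have "H b p (joint X A) = 0"
      using True H_const[OF b, of p "Tuple []"] by (simp add: joint_def)
    ultimately show ?thesis by simp
  next
    case False
    \<comment> \<open>The map \<open>3 - i\<close> exchanges 1 and 2, so \<open>j\<close> is the
      only index that \<open>A\<close> can contain.\<close>
    define j where "j = 3 - i"
    have ij: "i = 1 \<and> j = 2 \<or> i = 2 \<and> j = 1"
      using A(2) by (auto simp: j_def)
    have "A \<subseteq> {j}"
    proof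
      fix x assume "x \<in> A"
      then have "x \<in> {1..2}" "x \<noteq> i" using A by auto
      then show "x \<in> {j}" using ij by auto
    qed
    with False have A_eq: "A = {j}" by auto
    have j: "j \<in> {1..2}" using ij by auto
    have "H b p (joint X A) = H b p (X j)"
      by (rule H_cong[OF b finj[OF A(1)]]) (simp add: joint_eq_iff A_eq)
    moreover have "H b p (\<lambda>\<omega>. (joint X A \<omega>, X i \<omega>)) = H b p (\<lambda>\<omega>. (X 1 \<omega>, X 2 \<omega>))"
      by (rule H_cong[OF b finite_valued_Pair[OF finj[OF A(1)] fin'[OF A(2)]]])
         (use ij in \<open>auto simp: joint_eq_iff A_eq\<close>)
    ultimately show ?thesis using indep ij by auto
  qed
  have scheme: "perfect_scheme b 2 {A. A \<subseteq> {1..2} \<and> i \<in> A} p (X i) X" if i: "i \<in> {1..2}" for i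
    unfolding perfect_scheme_def
  proof (intro conjI allI impI)
    show "access_structure 2 {A. A \<subseteq> {1..2} \<and> i \<in> A}"
      by (auto simp: access_structure_def)
    show "finite_valued (X i)" by (rule fin'[OF i])
    show "\<forall>i\<in>{1..2}. finite_valued (X i)" using fin' by blast
    fix A :: "nat set" assume A: "A \<subseteq> {1..2}"
    { assume "A \<in> {A. A \<subseteq> {1..2} \<and> i \<in> A}"
      then show "H b p (\<lambda>\<omega>. (joint X A \<omega>, X i \<omega>)) = H b p (joint X A)"
        by (intro H_cong[OF b finite_valued_Pair[OF finj[OF A] fin'[OF i]]])
           (use finite_subset[OF A] in \<open>auto simp: joint_eq_iff\<close>) }
    { assume "A \<notin> {A. A \<subseteq> {1..2} \<and> i \<in> A}"
      then show "H b p (\<lambda>\<omega>. (joint X A \<omega>, X i \<omega>)) = H b p (joint X A) + H b p (X i)"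
        using Ij A i by auto }
  qed
  have cond: "cond_H b p (X i) (\<lambda>\<omega>. (joint X ({1..2} - {i}) \<omega>, joint X A \<omega>)) = H b p (X i)"
    if i: "i \<in> {1..2}" and A: "A \<subseteq> {1..2}" "i \<notin> A" for i A
  proof -
    let ?B = "{1..2} - {i}"
    have B: "?B \<subseteq> {1..2}" by blast
    \<comment> \<open>The shares in \<open>A\<close> are already among the other secrets, so
      conditioning on them as well changes nothing.\<close>
    have sub: "A \<subseteq> ?B" using A by blast
    have finA: "finite A" using finite_subset[OF A(1)] by simp
    have finP: "finite_valued (\<lambda>\<omega>. (joint X ?B \<omega>, joint X A \<omega>))"
      by (rule finite_valued_Pair[OF finj[OF B] finj[OF A(1)]])
    have pair: "joint X ?B \<omega> = joint X ?B \<omega>' \<and> joint X A \<omega> = joint X A \<omega>'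
        \<longleftrightarrow> joint X ?B \<omega> = joint X ?B \<omega>'" for \<omega> \<omega>'
      using sub finA by (auto simp: joint_eq_iff)
    have "H b p (\<lambda>\<omega>. (joint X ?B \<omega>, joint X A \<omega>)) = H b p (joint X ?B)"
      by (rule H_cong[OF b finP]) (use pair in auto)
    moreover have "H b p (\<lambda>\<omega>. ((joint X ?B \<omega>, joint X A \<omega>), X i \<omega>)) = H b p (\<lambda>\<omega>. (joint X ?B \<omega>, X i \<omega>))"
      by (rule H_cong[OF b finite_valued_Pair[OF finP fin'[OF i]]]) (use pair in auto)
    ultimately show ?thesis
      using cond_H_eq[OF b fin'[OF i] finP] Ij[OF B i] by simp
  qed
  show ?thesis
    unfolding scheme_combination_def using scheme cond by blast
qed

text \<open>Apply the secret sharing property to the sets \<open>{1}\<close> and \<open>{2}\<close>: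
  neither secret has both authorized, so the right-hand side is the entropy of a constant.
  Relabelling invariance replaces the pair of secrets by \<open>S\<close>.\<close>

lemma shared_info_independent_pair:
  fixes p :: "nat pmf" and Y Z :: rv
  assumes b: "b > 1" and I: "shared_information_measure I" "pairwise_secret_sharing b I"
    and fin: "finite_valued Y" "finite_valued Z" "finite_valued S"
    and indep: "H b p (\<lambda>\<omega>. (Y \<omega>, Z \<omega>)) = H b p Y + H b p Z"
    and S: "\<And>\<omega> \<omega>'. S \<omega> = S \<omega>' \<longleftrightarrow> Y \<omega> = Y \<omega>' \<and> Z \<omega> = Z \<omega>'"
  shows "I p S [Y, Z] = 0"
proof -
  define X :: "nat \<Rightarrow> rv" where "X i = (if i = 1 then Y else Z)" for i
  have "scheme_combination b 2 2 (\<lambda>i. {A. A \<subseteq> {1..2} \<and> i \<in> A}) p X X"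
    by (rule independent_pair_scheme_combination) (use b fin indep in \<open>auto simp: X_def\<close>)
  then have "shared_info I p (joint X {1, 2}) X [{1}, {2}] =
      H b p (joint X {i \<in> {1, 2}. set [{1}, {2}] \<subseteq> {A. A \<subseteq> {1..2} \<and> i \<in> A}})"
    using I(2) unfolding pairwise_secret_sharing_def
    by (elim allE[of _ 2] allE[of _ "\<lambda>i. {A. A \<subseteq> {1..2} \<and> i \<in> A}"] allE[of _ p] allE[of _ X]
        allE[of _ "[{1}, {2}] :: nat set list"]) auto
  also have "{i \<in> {1, 2}. set [{1}, {2}] \<subseteq> {A. A \<subseteq> {1..2::nat} \<and> i \<in> A}} = {}"
    by auto
  also have "H b p (joint X {}) = 0"
    using H_const[OF b, of p "Tuple []"] by (simp add: joint_def)
  finally have zero: "I p (joint X {1, 2}) [joint X {1}, joint X {2}] = 0"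
    by (simp add: shared_info_def)
  have "relabelling S (joint X {1, 2})" "list_all2 relabelling [Y, Z] [joint X {1}, joint X {2}]"
    by (auto simp: relabelling_iff joint_eq_iff X_def S)
  moreover have "rv_system S [Y, Z]"
    using fin by (simp add: rv_system_def)
  ultimately show ?thesis
    using I(1) zero unfolding shared_information_measure_def by metis
qed

section \<open>Partial information terms\<close>

text \<open>Induction that removes a maximal element \<open>m\<close>. As \<open>m\<close> lies
  below no other element, the remaining equations form the same system without \<open>m\<close>, and
  the equation at \<open>m\<close> then determines \<open>d m\<close>. Extensionality fixes the
  values outside \<open>P\<close>.\<close>

lemma ex1_moebius_inverse:
  fixes f :: "'a \<Rightarrow> 'b :: ab_group_add"
  assumes "finite P" "\<And>x. x \<in> P \<Longrightarrow> le x x"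
    and "\<And>x y. x \<in> P \<Longrightarrow> y \<in> P \<Longrightarrow> le x y \<Longrightarrow> le y x \<Longrightarrow> x = y"
    and "\<And>x y z. x \<in> P \<Longrightarrow> y \<in> P \<Longrightarrow> z \<in> P \<Longrightarrow> le x y \<Longrightarrow> le y z \<Longrightarrow> le x z"
  shows "\<exists>!d. d \<in> extensional P \<and> (\<forall>x\<in>P. f x = (\<Sum>y | y \<in> P \<and> le y x. d y))"
  using assms
proof (induction P rule: finite_psubset_induct)
  case (psubset P)
  show ?case
  proof (cases "P = {}")
    case True
    then show ?thesis by auto
  next
    case False
    \<comment> \<open>The strict part of \<open>le\<close> is asymmetric and transitive, so it has a
      maximal element on a nonempty finite set.\<close>
    define R where "R x y \<longleftrightarrow> le x y \<and> x \<noteq> y" for x y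
    have "asymp_on P R" "transp_on P R"
      using psubset.prems(2,3) unfolding R_def asymp_on_def transp_on_def by metis+
    from Finite_Set.bex_max_element[OF psubset.hyps this False] obtain m
      where m: "m \<in> P" "\<forall>x\<in>P. x \<noteq> m \<longrightarrow> \<not> R m x" by blast
    then have max: "\<not> le m x" if "x \<in> P" "x \<noteq> m" for x
      using that by (auto simp: R_def)
    define Q where "Q = P - {m}"
    have Q: "Q \<subset> P" "m \<notin> Q" "P = insert m Q" "finite Q"
      using m psubset.hyps by (auto simp: Q_def)
    have "\<exists>!d. d \<in> extensional Q \<and> (\<forall>x\<in>Q. f x = (\<Sum>y | y \<in> Q \<and> le y x. d y))"
      by (rule psubset.IH[OF Q(1)]) (use psubset.prems Q(1) in \<open>blast+\<close>)
    then obtain e where e: "e \<in> extensional Q" "\<forall>x\<in>Q. f x = (\<Sum>y | y \<in> Q \<and> le y x. e y)"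
      and e_unique: "\<And>d. d \<in> extensional Q \<Longrightarrow> (\<forall>x\<in>Q. f x = (\<Sum>y | y \<in> Q \<and> le y x. d y)) \<Longrightarrow> d = e"
      by (elim ex1E) blast
    have below: "{y \<in> P. le y x} = {y \<in> Q. le y x}" if "x \<in> Q" for x
      using that max Q by auto
    have below_m: "{y \<in> P. le y m} = insert m {y \<in> Q. le y m}"
      using Q psubset.prems(1) by auto
    have sum_m: "(\<Sum>y | y \<in> P \<and> le y m. d y) = d m + (\<Sum>y | y \<in> Q \<and> le y m. d y)" for d :: "'a \<Rightarrow> 'b"
      unfolding below_m using Q by simp
    \<comment> \<open>The new value is the one that solves the equation at \<open>m\<close>.\<close>
    define d where "d = e(m := f m - (\<Sum>y | y \<in> Q \<and> le y m. e y))"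
    have d_e: "(\<Sum>y | y \<in> Q \<and> le y x. d y) = (\<Sum>y | y \<in> Q \<and> le y x. e y)" for x
      by (rule sum.cong) (use Q in \<open>auto simp: d_def\<close>)
    show ?thesis
    proof (rule ex1I[of _ d], intro conjI ballI)
      show "d \<in> extensional P"
        using e(1) Q by (auto simp: d_def extensional_def)
      fix x assume x: "x \<in> P"
      show "f x = (\<Sum>y | y \<in> P \<and> le y x. d y)"
      proof (cases "x = m")
        case True
        then show ?thesis
          using sum_m[of d] d_e[of m] by (simp add: d_def)
      next
        case False
        then have "x \<in> Q" using x by (simp add: Q_def)
        then show ?thesis using below d_e e(2) by simp
      qed
    next
      fix d' assume d': "d' \<in> extensional P \<and> (\<forall>x\<in>P. f x = (\<Sum>y | y \<in> P \<and> le y x. d' y))"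
      \<comment> \<open>Uniqueness of \<open>e\<close> concerns functions extensional on
        \<open>Q\<close>, so the value of \<open>d'\<close> at \<open>m\<close> has to be cut off
        first.\<close>
      have restr: "(\<Sum>y | y \<in> Q \<and> le y x. restrict d' Q y) = (\<Sum>y | y \<in> Q \<and> le y x. d' y)" for x
        by (rule sum.cong) auto
      have "restrict d' Q = e"
        by (rule e_unique) (use d' below Q restr in auto)
      with restr have d'_e: "(\<Sum>y | y \<in> Q \<and> le y m. d' y) = (\<Sum>y | y \<in> Q \<and> le y m. e y)"
        by simp
      show "d' = d"
      proof
        fix x
        consider "x = m" | "x \<in> Q" | "x \<notin> P" using Q by blast
        then show "d' x = d x"
        proof cases
          case 1
          have "f m = d' m + (\<Sum>y | y \<in> Q \<and> le y m. e y)"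
            using d' m(1) sum_m[of d'] d'_e by auto
          then show ?thesis using 1 by (simp add: d_def)
        next
          case 2
          then have "x \<noteq> m" using Q by blast
          then show ?thesis using 2 \<open>restrict d' Q = e\<close> by (auto simp: d_def)
        next
          case 3
          then show ?thesis
            using d' e(1) m(1) Q by (auto simp: d_def extensional_def)
        qed
      qed
    qed
  qed
qed

lemma finite_antichains: "finite (antichains n)"
  by (rule finite_subset[of _ "Pow (Pow {1..n})"]) (auto simp: antichains_def)

lemma antichain_le_refl: "antichain_le \<AA> \<AA>"
  by (auto simp: antichain_le_def)

lemma antichain_le_trans: "antichain_le \<AA> \<BB> \<Longrightarrow> antichain_le \<BB> \<CC> \<Longrightarrow> antichain_le \<AA> \<CC>"
  unfolding antichain_le_def by (meson order_trans)

text \<open>A member \<open>C\<close> of one antichain contains some \<open>D\<close> of the other,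
  which contains some \<open>C'\<close> of the first. Incomparability gives \<open>C' = C\<close>,
  hence \<open>D = C\<close>.\<close>

lemma antichain_le_antisym:
  assumes "\<AA> \<in> antichains n" "\<BB> \<in> antichains n" "antichain_le \<AA> \<BB>" "antichain_le \<BB> \<AA>"
  shows "\<AA> = \<BB>"
proof -
  have *: "\<CC> \<subseteq> \<DD>" if \<CC>\<DD>: "\<CC> \<in> antichains n" "antichain_le \<CC> \<DD>" "antichain_le \<DD> \<CC>" for \<CC> \<DD>
  proof
    fix C assume "C \<in> \<CC>"
    obtain D where D: "D \<in> \<DD>" "D \<subseteq> C"
      using \<CC>\<DD>(3) \<open>C \<in> \<CC>\<close> unfolding antichain_le_def by blast
    obtain C' where C': "C' \<in> \<CC>" "C' \<subseteq> D"
      using \<CC>\<DD>(2) D unfolding antichain_le_def by blast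
    have "C' \<subseteq> C" using C' D by blast
    then have "C' = C"
      using \<CC>\<DD>(1) C'(1) \<open>C \<in> \<CC>\<close> by (simp add: antichains_def)
    then show "C \<in> \<DD>" using C' D by auto
  qed
  show ?thesis using *[of \<AA> \<BB>] *[of \<BB> \<AA>] assms by blast
qed

text \<open>The definite description in \<open>partial_info\<close> yields its equation only once
  existence and uniqueness are known; Moebius inversion over the antichains provides both.\<close>

lemma shared_info_eq_sum_partial_info:
  assumes "symmetry I" "finite_valued S" and X: "\<forall>i\<in>{1..n}. finite_valued (X i)"
    and As: "distinct As" "set As \<in> antichains n"
  shows "shared_info I p S X As =
    (\<Sum>\<BB> | \<BB> \<in> antichains n \<and> antichain_le \<BB> (set As). partial_info I n p S X \<BB>)"
proof -
  define enum where "enum \<AA> = (SOME As. distinct As \<and> set As = \<AA>)" for \<AA> :: "nat set set"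
  have enum: "distinct (enum \<AA>) \<and> set (enum \<AA>) = \<AA>" if "\<AA> \<in> antichains n" for \<AA>
  proof -
    have "\<AA> \<subseteq> Pow {1..n}"
      using that by (auto simp: antichains_def)
    then have "finite \<AA>" by (rule finite_subset) simp
    then show ?thesis
      unfolding enum_def using someI_ex[OF finite_distinct_list[of \<AA>]] by (auto simp: conj_commute)
  qed
  have sys: "rv_system S (map (joint X) As)" if "set As \<in> antichains n" for As
  proof -
    have "finite_valued (joint X A)" if "A \<in> set As" for A
    proof -
      have A: "A \<subseteq> {1..n}"
        using that \<open>set As \<in> antichains n\<close> by (auto simp: antichains_def)
      show ?thesis
        by (rule finite_valued_joint) (use A X finite_subset[OF A] in auto)
    qed
    then show ?thesis
      using assms(2) that by (auto simp: rv_system_def antichains_def)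
  qed
  have enum_eq: "shared_info I p S X As = shared_info I p S X (enum (set As))"
    if "distinct As" "set As \<in> antichains n" for As
  proof -
    have "mset As = mset (enum (set As))"
      using that enum[OF that(2)] by (metis set_eq_iff_mset_eq_distinct)
    then have "mset (map (joint X) As) = mset (map (joint X) (enum (set As)))"
      by simp
    then show ?thesis
      using assms(1) sys[OF that(2)] unfolding symmetry_def shared_info_def by blast
  qed
  let ?P = "\<lambda>d. d \<in> extensional (antichains n) \<and>
        (\<forall>As. distinct As \<and> set As \<in> antichains n \<longrightarrow>
           shared_info I p S X As = (\<Sum>\<BB> | \<BB> \<in> antichains n \<and> antichain_le \<BB> (set As). d \<BB>))"
  \<comment> \<open>By symmetry, one equation per antichain, for the chosen enumeration, is as
    strong as one per enumeration. This is the form that Moebius inversion handles.\<close>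
  have "?P d \<longleftrightarrow> d \<in> extensional (antichains n) \<and>
      (\<forall>\<AA>\<in>antichains n. shared_info I p S X (enum \<AA>) =
        (\<Sum>\<BB> | \<BB> \<in> antichains n \<and> antichain_le \<BB> \<AA>. d \<BB>))" for d :: "nat set set \<Rightarrow> real"
  proof (intro conj_cong refl iffI ballI allI impI)
    fix \<AA>
    assume "\<forall>As. distinct As \<and> set As \<in> antichains n \<longrightarrow>
        shared_info I p S X As = (\<Sum>\<BB> | \<BB> \<in> antichains n \<and> antichain_le \<BB> (set As). d \<BB>)"
      and "\<AA> \<in> antichains n"
    then show "shared_info I p S X (enum \<AA>) =
        (\<Sum>\<BB> | \<BB> \<in> antichains n \<and> antichain_le \<BB> \<AA>. d \<BB>)"
      using enum by simp
  next
    fix As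
    assume "\<forall>\<AA>\<in>antichains n. shared_info I p S X (enum \<AA>) =
        (\<Sum>\<BB> | \<BB> \<in> antichains n \<and> antichain_le \<BB> \<AA>. d \<BB>)"
      and "distinct As \<and> set As \<in> antichains n"
    then show "shared_info I p S X As =
        (\<Sum>\<BB> | \<BB> \<in> antichains n \<and> antichain_le \<BB> (set As). d \<BB>)"
      using enum_eq by simp
  qed
  then have "\<exists>!d. ?P d"
    using ex1_moebius_inverse[of "antichains n" antichain_le "\<lambda>\<AA>. shared_info I p S X (enum \<AA>)",
        OF finite_antichains antichain_le_refl antichain_le_antisym antichain_le_trans]
    by simp
  from theI'[OF this] show ?thesis
    unfolding partial_info_def using As by blast
qed

text \<open>Once the points where \<open>d\<close> vanishes are discarded, the sets
  \<open>F i\<close> are pairwise disjoint. Their sums add up to the sum over a subset of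
  \<open>D\<close>, and the rest of \<open>D\<close> contributes nonnegatively.\<close>

lemma sum_le_sum_if_null_overlaps:
  fixes d :: "'a \<Rightarrow> real"
  assumes "finite K" "finite D" "\<And>i. i \<in> K \<Longrightarrow> F i \<subseteq> D" "\<And>x. x \<in> D \<Longrightarrow> d x \<ge> 0"
    and "\<And>i j x. i \<in> K \<Longrightarrow> j \<in> K \<Longrightarrow> i \<noteq> j \<Longrightarrow> x \<in> F i \<Longrightarrow> x \<in> F j \<Longrightarrow> d x = 0"
  shows "(\<Sum>i\<in>K. sum d (F i)) \<le> sum d D"
proof -
  have fin: "finite (F i)" if "i \<in> K" for i
    using assms(2,3) that finite_subset by blast
  let ?G = "\<lambda>i. {x \<in> F i. d x \<noteq> 0}"
  have "(\<Sum>i\<in>K. sum d (F i)) = (\<Sum>i\<in>K. sum d (?G i))"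
    by (intro sum.cong refl sum.mono_neutral_right) (use fin in auto)
  also have "\<dots> = sum d (\<Union>i\<in>K. ?G i)"
  proof (rule sum.UNION_disjoint[symmetric, OF assms(1)])
    show "\<forall>i\<in>K. finite (?G i)"
      using fin by simp
    show "\<forall>i\<in>K. \<forall>j\<in>K. i \<noteq> j \<longrightarrow> ?G i \<inter> ?G j = {}"
      using assms(5) by blast
  qed
  also have "\<dots> \<le> sum d D"
    by (rule sum_mono2) (use assms in auto)
  finally show ?thesis .
qed

section \<open>The parity distribution\<close>

text \<open>Only the points 0 to 3 carry mass. The variables below read
  \<open>\<omega> mod 4\<close>, so that they take no further values on the rest of
  \<open>nat\<close> and their functional dependencies hold at every point.\<close>

definition parity_pmf :: "nat pmf" where
  "parity_pmf = pmf_of_set {0..<4}"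

definition parity_target :: rv where
  "parity_target \<omega> = Atom (\<omega> mod 4)"

text \<open>
  On \<open>\<omega> = 0, 1, 2, 3\<close> the three bits are \<open>111\<close>, \<open>100\<close>, \<open>010\<close>, \<open>001\<close>, the words of odd parity.
\<close>

definition parity_bit :: "nat \<Rightarrow> rv" where
  "parity_bit i \<omega> = Atom (if \<omega> mod 4 \<in> {0, i} then 1 else 0)"

lemma finite_valued_parity_target: "finite_valued parity_target"
  unfolding finite_valued_def parity_target_def
  by (rule finite_subset[of _ "Atom ` {0..<4}"]) auto

lemma finite_valued_parity_bit: "finite_valued (parity_bit i)"
  unfolding finite_valued_def parity_bit_def
  by (rule finite_subset[of _ "{Atom 0, Atom 1}"]) (simp_all add: image_subset_iff)

text \<open>Membership in \<open>{0, i}\<close> and in \<open>{0, j}\<close> separates the four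
  residues: 0 lies in both sets, \<open>i\<close> and \<open>j\<close> in one each, the fourth
  residue in neither.\<close>

lemma parity_target_eq_iff:
  assumes "i \<in> {1..3}" "j \<in> {1..3}" "i \<noteq> j"
  shows "parity_target \<omega> = parity_target \<omega>' \<longleftrightarrow>
    parity_bit i \<omega> = parity_bit i \<omega>' \<and> parity_bit j \<omega> = parity_bit j \<omega>'"
proof -
  have cases: "i = 1 \<or> i = 2 \<or> i = 3" "j = 1 \<or> j = 2 \<or> j = 3"
    using assms(1,2) by auto
  have "m = m' \<longleftrightarrow> (m \<in> {0, i} \<longleftrightarrow> m' \<in> {0, i}) \<and> (m \<in> {0, j} \<longleftrightarrow> m' \<in> {0, j})"
    if "m < 4" "m' < 4" for m m' :: nat
  proof -
    have "m = 0 \<or> m = 1 \<or> m = 2 \<or> m = 3" "m' = 0 \<or> m' = 1 \<or> m' = 2 \<or> m' = 3"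
      using that by auto
    with cases assms(3) show ?thesis
      by (elim disjE) simp_all
  qed
  from this[of "\<omega> mod 4" "\<omega>' mod 4"] show ?thesis
    by (simp add: parity_target_def parity_bit_def del: insert_iff)
qed

lemma H_parity_target:
  assumes "b > 1"
  shows "H b parity_pmf parity_target = 2 * log b 2"
proof -
  have range: "range parity_target = Atom ` {0..<4}"
    unfolding parity_target_def by (auto simp: image_iff) (metis mod_less)
  have card: "card (range parity_target) = 4"
    unfolding range by (subst card_image) (auto simp: inj_on_def)
  have fib: "{0..<4} \<inter> parity_target -` {Atom k} = {k}" if "k < 4" for k
    using that by (auto simp: parity_target_def)
  have "H b parity_pmf parity_target = log b (real (card (range parity_target)))"
  proof (rule H_uniform[OF assms finite_valued_parity_target], unfold card)
    fix x assume "x \<in> range parity_target"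
    then obtain k where "k < 4" "x = Atom k"
      by (auto simp: range)
    then show "measure parity_pmf (parity_target -` {x}) = 1 / real 4"
      by (simp add: parity_pmf_def measure_pmf_of_set fib)
  qed
  also have "\<dots> = log b (2 ^ 2)"
    by (simp add: card)
  also have "\<dots> = 2 * log b 2"
    by (subst log_nat_power) auto
  finally show ?thesis .
qed

lemma H_parity_bit:
  assumes "b > 1" "i \<in> {1..3}"
  shows "H b parity_pmf (parity_bit i) = log b 2"
proof -
  have i: "i = 1 \<or> i = 2 \<or> i = 3" using assms(2) by auto
  have range: "range (parity_bit i) = {Atom 0, Atom 1}"
  proof
    show "range (parity_bit i) \<subseteq> {Atom 0, Atom 1}"
      by (simp add: image_subset_iff parity_bit_def)
    \<comment> \<open>The first witness is a residue other than 0 and \<open>i\<close>.\<close>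
    have "parity_bit i (if i = 1 then 2 else 1) = Atom 0" "parity_bit i 0 = Atom 1"
      using i by (auto simp: parity_bit_def)
    then show "{Atom 0, Atom 1} \<subseteq> range (parity_bit i)"
      by (metis empty_subsetI insert_subset rangeI)
  qed
  have card: "card (range (parity_bit i)) = 2"
    unfolding range by simp
  have four: "{0..<4} = {0, 1, 2, 3::nat}" by auto
  have "H b parity_pmf (parity_bit i) = log b (real (card (range (parity_bit i))))"
  proof (rule H_uniform[OF assms(1) finite_valued_parity_bit], unfold card)
    fix x assume "x \<in> range (parity_bit i)"
    then have "x = Atom 0 \<or> x = Atom 1"
      by (auto simp: range)
    \<comment> \<open>The bit is 1 at the points 0 and \<open>i\<close>, and 0 at the other
      two.\<close>
    then have "card ({0..<4} \<inter> parity_bit i -` {x}) = 2"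
      unfolding four using i by (auto simp: parity_bit_def Int_insert_left)
    then show "measure parity_pmf (parity_bit i -` {x}) = 1 / real 2"
      by (simp add: parity_pmf_def measure_pmf_of_set)
  qed
  then show ?thesis by (simp add: card)
qed

theorem theorem2:
  fixes b :: real and I :: info_measure
  assumes "b > 1"
    and "shared_information_measure I"
    and "williams_beer b I"
    and "pairwise_secret_sharing b I"
  shows "\<exists>(n::nat) (p :: nat pmf) (S :: rv) (X :: nat \<Rightarrow> rv) \<AA>.
           n \<ge> 1 \<and> finite_valued S \<and> (\<forall>i\<in>{1..n}. finite_valued (X i)) \<and>
           \<AA> \<in> antichains n \<and> partial_info I n p S X \<AA> < 0"
proof (rule ccontr)
  let ?p = parity_pmf and ?S = parity_target and ?X = parity_bit
  define d where "d = partial_info I 3 ?p ?S ?X"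
  \<comment> \<open>These down-sets are the index sets of the Moebius sums.\<close>
  define D where "D \<AA> = {\<BB> \<in> antichains 3. antichain_le \<BB> \<AA>}" for \<AA>
  note finS = finite_valued_parity_target and finX = finite_valued_parity_bit
  have sym: "symmetry I" and self: "self_redundancy b I" and mono: "monotonicity I"
    using assms(3) by (auto simp: williams_beer_def)
  assume "\<not> ?thesis"
  then have nonneg: "d \<AA> \<ge> 0" if "\<AA> \<in> antichains 3" for \<AA>
    using that finS finX unfolding d_def
    by (metis (no_types, lifting) not_less one_le_numeral)
  have D_sub: "D \<AA> \<subseteq> antichains 3" and finD: "finite (D \<AA>)" for \<AA>
    using finite_antichains by (auto simp: D_def)
  have sum_D: "shared_info I ?p ?S ?X As = sum d (D (set As))"
    if "distinct As" "set As \<in> antichains 3" for As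
    using shared_info_eq_sum_partial_info[OF sym finS _ that, of ?X ?p] finX
    by (simp add: d_def D_def)
  have finJ: "finite_valued (joint ?X A)" if "finite A" for A
    using that finX by (rule finite_valued_joint)
  have absorb: "I ?p ?S (Ys @ [Z]) = I ?p ?S Ys"
    if "rv_system ?S Ys" "finite_valued Z" "Y \<in> set Ys" "function_of ?p Y Z" for Ys Y Z
    using mono that unfolding monotonicity_def by blast

  have null: "sum d (D {{i}, {j}}) = 0" if ij: "i \<in> {1..3}" "j \<in> {1..3}" "i \<noteq> j" for i j
  proof -
    let ?Y = "joint ?X {i}" and ?Z = "joint ?X {j}"
    have HY: "H b ?p (joint ?X {k}) = log b 2" if "k \<in> {1..3}" for k
      using H_cong[OF assms(1) finJ[of "{k}"], of "?X k" ?p] H_parity_bit[OF assms(1) that]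
      by (simp add: joint_eq_iff)
    \<comment> \<open>Independence by counting: the pair has the fibres of the target, hence two
      bits of entropy, and each component has one.\<close>
    have "H b ?p (\<lambda>\<omega>. (?Y \<omega>, ?Z \<omega>)) = H b ?p ?S"
      by (rule H_cong[OF assms(1) finite_valued_Pair[OF finJ finJ]])
         (simp_all add: joint_eq_iff parity_target_eq_iff[OF ij])
    then have "H b ?p (\<lambda>\<omega>. (?Y \<omega>, ?Z \<omega>)) = H b ?p ?Y + H b ?p ?Z"
      using HY ij H_parity_target[OF assms(1)] by simp
    then have "I ?p ?S [?Y, ?Z] = 0"
      by (intro shared_info_independent_pair[OF assms(1,2,4) finJ finJ finS])
         (simp_all add: joint_eq_iff parity_target_eq_iff[OF ij])
    then show ?thesis
      using sum_D[of "[{i}, {j}]"] ij by (auto simp: shared_info_def antichains_def)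
  qed

  have one: "sum d (D {{i}, {1..3} - {i}}) = log b 2" if i: "i \<in> {1..3}" for i
  proof -
    let ?B = "{1..3} - {i}"
    have i': "i = 1 \<or> i = 2 \<or> i = 3" using i by auto
    obtain j k where jk: "?B = {j, k}" "j \<in> {1..3}" "k \<in> {1..3}" "j \<noteq> k"
    proof -
      \<comment> \<open>The smaller and the larger of the two remaining indices.\<close>
      have "?B = {if i = 1 then 2 else 1, if i = 3 then 2 else 3}"
        using i' by auto
      then show thesis
        by (rule that) (use i' in auto)
    qed
    have BB: "{i} \<noteq> ?B" "{{i}, ?B} \<in> antichains 3"
    proof -
      have "i \<notin> ?B" "?B \<noteq> {}" "\<not> ?B \<subseteq> {i}" using jk by blast+
      then show "{i} \<noteq> ?B" "{{i}, ?B} \<in> antichains 3"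
        using i unfolding antichains_def by blast+
    qed
    have det: "joint ?X {i} \<omega> = joint ?X {i} \<omega>'" if "joint ?X ?B \<omega> = joint ?X ?B \<omega>'" for \<omega> \<omega>'
    proof -
      \<comment> \<open>The two other bits fix the target, and the target fixes every bit.\<close>
      have "?S \<omega> = ?S \<omega>'"
        using that unfolding parity_target_eq_iff[OF jk(2-4)] jk(1) by (simp add: joint_eq_iff)
      then show ?thesis
        by (simp add: joint_eq_iff parity_target_def parity_bit_def)
    qed
    have "function_of ?p (joint ?X {i}) (joint ?X ?B)"
      by (rule function_ofI) (rule det)
    moreover have "rv_system ?S [joint ?X {i}]"
      using finS finJ by (simp add: rv_system_def)
    ultimately have "I ?p ?S [joint ?X {i}, joint ?X ?B] = I ?p ?S [joint ?X {i}]"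
      using absorb[of "[joint ?X {i}]" "joint ?X ?B" "joint ?X {i}"] finJ by simp
    also have "\<dots> = MI b ?p ?S (joint ?X {i})"
      using self finS finJ[of "{i}"] unfolding self_redundancy_def by simp
    also have "\<dots> = H b ?p (joint ?X {i})"
      by (rule MI_function[OF assms(1) finS _ finJ])
         (simp_all add: joint_eq_iff parity_target_def parity_bit_def)
    also have "\<dots> = H b ?p (?X i)"
      by (rule H_cong[OF assms(1) finJ]) (simp_all add: joint_eq_iff)
    also have "\<dots> = log b 2"
      by (rule H_parity_bit[OF assms(1) i])
    finally show ?thesis
      using sum_D[of "[{i}, ?B]"] BB by (simp add: shared_info_def)
  qed

  let ?M = "{{1, 2}, {1, 3}, {2, 3}} :: nat set set"
  have three: "{1..3} = {1, 2, 3::nat}" by auto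
  have M: "?M \<in> antichains 3"
    unfolding antichains_def by (auto simp: doubleton_eq_iff)
  have two: "sum d (D ?M) = 2 * log b 2"
  proof -
    let ?Y = "joint ?X {1, 2}" and ?Z = "joint ?X {1, 3}" and ?W = "joint ?X {2, 3}"
    have eqS: "joint ?X {i, j} \<omega> = joint ?X {i, j} \<omega>' \<longleftrightarrow> ?S \<omega> = ?S \<omega>'"
      if "i \<in> {1..3}" "j \<in> {1..3}" "i \<noteq> j" for i j \<omega> \<omega>'
      using parity_target_eq_iff[OF that] by (simp add: joint_eq_iff)
    have "function_of ?p ?Y ?Z" "function_of ?p ?Y ?W"
      by (rule function_ofI; simp add: eqS)+
    moreover have "rv_system ?S [?Y]" "rv_system ?S [?Y, ?Z]"
      using finS finJ by (simp_all add: rv_system_def)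
    \<comment> \<open>Each pair of bits determines the target and so any other pair; the equality
      case of monotonicity drops \<open>?W\<close> and then \<open>?Z\<close>.\<close>
    ultimately have "I ?p ?S [?Y, ?Z, ?W] = I ?p ?S [?Y]"
      using absorb[of "[?Y]" ?Z ?Y] absorb[of "[?Y, ?Z]" ?W ?Y] finJ by simp
    also have "\<dots> = MI b ?p ?S ?Y"
      using self finS finJ[of "{1, 2}"] unfolding self_redundancy_def by simp
    also have "\<dots> = H b ?p ?Y"
      by (rule MI_function[OF assms(1) finS _ finJ]) (simp_all add: eqS)
    also have "\<dots> = H b ?p ?S"
      by (rule H_cong[OF assms(1) finJ]) (simp_all add: eqS)
    also have "\<dots> = 2 * log b 2"
      by (rule H_parity_target[OF assms(1)])
    finally show ?thesis
      using sum_D[of "[{1, 2}, {1, 3}, {2, 3}]"] M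
      by (simp add: shared_info_def doubleton_eq_iff)
  qed

  have "(\<Sum>i\<in>{1..3}. sum d (D {{i}, {1..3} - {i}})) \<le> sum d (D ?M)"
  proof (rule sum_le_sum_if_null_overlaps)
    show "D {{i}, {1..3} - {i}} \<subseteq> D ?M" if "i \<in> {1..3}" for i
    proof -
      \<comment> \<open>Two members of \<open>?M\<close> contain \<open>i\<close>; the third is the
        complement of \<open>{i}\<close>.\<close>
      have "antichain_le {{i}, {1..3} - {i}} ?M"
        using that unfolding antichain_le_def three by auto
      then show ?thesis
        using antichain_le_trans by (auto simp: D_def)
    qed
    show "d \<BB> = 0"
      if ij: "i \<in> {1..3}" "j \<in> {1..3}" "i \<noteq> j"
        and \<BB>: "\<BB> \<in> D {{i}, {1..3} - {i}}" "\<BB> \<in> D {{j}, {1..3} - {j}}" for i j \<BB>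
    proof -
      \<comment> \<open>Being below both antichains, \<open>\<BB>\<close> has a member inside
        \<open>{i}\<close> and one inside \<open>{j}\<close>. The terms below
        \<open>{{i}, {j}}\<close> are nonnegative with sum zero, so each of them vanishes.\<close>
      have "\<BB> \<in> D {{i}, {j}}"
        using \<BB> by (auto simp: D_def antichain_le_def)
      moreover have "\<forall>\<CC>\<in>D {{i}, {j}}. d \<CC> = 0"
        using null[OF ij] finD nonneg D_sub by (subst (asm) sum_nonneg_eq_0_iff) auto
      ultimately show ?thesis by blast
    qed
  qed (use finD D_sub nonneg in auto)
  then have "3 * log b 2 \<le> 2 * log b 2"
    using one two by simp
  moreover have "log b 2 > 0"
    using assms(1) by simp
  ultimately show False by linarith
qed

end
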